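(* Let $X$ be a normed space, $\varphi_1,\varphi_2\colon X\to\mathbb{R}_\infty$, and $U\subset X$ with $\operatorname{dom}\varphi_1\cap\operatorname{dom}\varphi_2\cap U\ne\emptyset$. Let $\varphi_1$ and $\varphi_2$ be weakly sequentially lower semicontinuous on $U$ and $\inf_U\varphi_2>-\infty$. The pair $(\varphi_1,\varphi_2)$ is (i) uniformly lower semicontinuous on $U$ if $\{x\in U\mid\varphi_1(x)\le c\}$ is weakly sequentially compact for each $c\in\mathbb{R}$; (ii) quasiuniformly lower semicontinuous on $U$ if $\operatorname{cl}^wV\subset U$ and $\{x\in\operatorname{cl}^wV\mid\varphi_1(x)\le c\}$ is weakly sequentially compact for each $V\in EI(U)$ and $c\in\mathbb{R}$, where $\operatorname{cl}^wV$ stands for the closure of $V$ with respect to the weak topology in $X$.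
   Context: $\mathbb{R}_\infty:=\mathbb{R}\cup\{+\infty\}$, $\operatorname{dom}\varphi:=\{x\mid\varphi(x)<+\infty\}$, $\inf\emptyset=+\infty$. A set $V\subset X$ is an essentially interior subset of $U$ if $\bigcup_{x\in V}B_\rho(x)\subset U$ for some $\rho>0$ ($B_\rho$ = open ball); $EI(U)$ is the collection of all such $V$ (including $\emptyset$). Put $$\Lambda_U^\circ(\varphi_1,\varphi_2):=\lim_{\eta\downarrow0}\ \inf_{x_1,x_2\in U,\ \|x_1-x_2\|<\eta}(\varphi_1(x_1)+\varphi_2(x_2)),\qquad \Lambda_U^\dagger(\varphi_1,\varphi_2):=\inf_{V\in EI(U)}\Lambda_V^\circ(\varphi_1,\varphi_2).$$ The pair $(\varphi_1,\varphi_2)$ is uniformly lower semicontinuous on $U$ if $\inf_U(\varphi_1+\varphi_2)\le\Lambda_U^\circ(\varphi_1,\varphi_2)$, and quasiuniformly lower semicontinuous on $U$ if $\inf_U(\varphi_1+\varphi_2)\le\Lambda_U^\dagger(\varphi_1,\varphi_2)$. *)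

theory Defs
  imports "HOL-Analysis.Analysis"
begin

text \<open>Functions with values in \<open>\<real> \<union> {+\<infinity>}\<close> are modelled as \<^typ>\<open>'a \<Rightarrow> ereal\<close> that never take
  the value \<open>-\<infinity>\<close>. Infima are taken in \<^typ>\<open>ereal\<close>, so the infimum over the empty set is \<open>+\<infinity>\<close>.\<close>

definition never_minus_infinity :: "('a \<Rightarrow> ereal) \<Rightarrow> bool" where
  "never_minus_infinity \<phi> \<longleftrightarrow> (\<forall>x. \<phi> x \<noteq> - \<infinity>)"

definition eff_dom :: "('a \<Rightarrow> ereal) \<Rightarrow> 'a set" where
  "eff_dom \<phi> = {x. \<phi> x < \<infinity>}"

definition EI :: "'a::real_normed_vector set \<Rightarrow> 'a set set" where
  "EI U = {V. \<exists>\<rho>>0. (\<Union>x\<in>V. ball x \<rho>) \<subseteq> U}"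

definition Lambda_inf ::
  "'a::real_normed_vector set \<Rightarrow> ('a \<Rightarrow> ereal) \<Rightarrow> ('a \<Rightarrow> ereal) \<Rightarrow> real \<Rightarrow> ereal" where
  "Lambda_inf U \<phi>1 \<phi>2 \<eta> =
     (INF (x1, x2) \<in> {(x1, x2). x1 \<in> U \<and> x2 \<in> U \<and> norm (x1 - x2) < \<eta>}. \<phi>1 x1 + \<phi>2 x2)"

definition Lambda_circ ::
  "'a::real_normed_vector set \<Rightarrow> ('a \<Rightarrow> ereal) \<Rightarrow> ('a \<Rightarrow> ereal) \<Rightarrow> ereal" where
  "Lambda_circ U \<phi>1 \<phi>2 = Lim (at_right 0) (Lambda_inf U \<phi>1 \<phi>2)"

text \<open>The limit defining \<^const>\<open>Lambda_circ\<close> always exists in \<^typ>\<open>ereal\<close>, because the infimum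
  increases as \<open>\<eta>\<close> decreases.\<close>

lemma Lambda_inf_antimono:
  assumes "\<eta> \<le> \<eta>'"
  shows "Lambda_inf U \<phi>1 \<phi>2 \<eta>' \<le> Lambda_inf U \<phi>1 \<phi>2 \<eta>"
  unfolding Lambda_inf_def using assms by (intro INF_superset_mono) auto

lemma tendsto_Lambda_circ:
  "(Lambda_inf U \<phi>1 \<phi>2 \<longlongrightarrow> Lambda_circ U \<phi>1 \<phi>2) (at_right 0)"
proof -
  let ?s = "SUP \<eta>\<in>{0<..}. Lambda_inf U \<phi>1 \<phi>2 \<eta>"
  have "(Lambda_inf U \<phi>1 \<phi>2 \<longlongrightarrow> ?s) (at_right 0)"
  proof (rule increasing_tendsto)
    show "\<forall>\<^sub>F \<eta> in at_right 0. Lambda_inf U \<phi>1 \<phi>2 \<eta> \<le> ?s"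
      unfolding eventually_at_right_field by (auto intro!: exI[of _ 1] SUP_upper)
  next
    fix y assume "y < ?s"
    then obtain \<eta> where \<eta>: "\<eta> > 0" "y < Lambda_inf U \<phi>1 \<phi>2 \<eta>"
      by (auto simp: less_SUP_iff)
    have "y < Lambda_inf U \<phi>1 \<phi>2 t" if "t < \<eta>" for t
      using \<eta>(2) Lambda_inf_antimono[of t \<eta> U \<phi>1 \<phi>2] that by (auto intro: less_le_trans)
    then show "\<forall>\<^sub>F t in at_right 0. y < Lambda_inf U \<phi>1 \<phi>2 t"
      unfolding eventually_at_right_field using \<eta>(1) by auto
  qed
  then show ?thesis
    unfolding Lambda_circ_def by (simp add: tendsto_Lim trivial_limit_at_right_real)
qed

definition Lambda_dagger ::
  "'a::real_normed_vector set \<Rightarrow> ('a \<Rightarrow> ereal) \<Rightarrow> ('a \<Rightarrow> ereal) \<Rightarrow> ereal" where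
  "Lambda_dagger U \<phi>1 \<phi>2 = (INF V\<in>EI U. Lambda_circ V \<phi>1 \<phi>2)"

definition uniformly_lsc_pair ::
  "'a::real_normed_vector set \<Rightarrow> ('a \<Rightarrow> ereal) \<Rightarrow> ('a \<Rightarrow> ereal) \<Rightarrow> bool" where
  "uniformly_lsc_pair U \<phi>1 \<phi>2 \<longleftrightarrow> (INF x\<in>U. \<phi>1 x + \<phi>2 x) \<le> Lambda_circ U \<phi>1 \<phi>2"

definition quasiuniformly_lsc_pair ::
  "'a::real_normed_vector set \<Rightarrow> ('a \<Rightarrow> ereal) \<Rightarrow> ('a \<Rightarrow> ereal) \<Rightarrow> bool" where
  "quasiuniformly_lsc_pair U \<phi>1 \<phi>2 \<longleftrightarrow> (INF x\<in>U. \<phi>1 x + \<phi>2 x) \<le> Lambda_dagger U \<phi>1 \<phi>2"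

text \<open>The weak topology: the coarsest topology making all continuous linear functionals continuous.\<close>

definition weak_topology :: "'a::real_normed_vector topology" where
  "weak_topology = topology_generated_by
     {f -` S | (f :: 'a \<Rightarrow> real) S. bounded_linear f \<and> open S}"

definition weakly_seq_compact :: "'a::real_normed_vector set \<Rightarrow> bool" where
  "weakly_seq_compact S \<longleftrightarrow>
     (\<forall>u :: nat \<Rightarrow> 'a. range u \<subseteq> S \<longrightarrow>
        (\<exists>l\<in>S. \<exists>r. strict_mono r \<and> limitin weak_topology (u \<circ> r) l sequentially))"

text \<open>Only sequences staying in \<open>U\<close> are considered, i.e. the notion concerns the restriction of
  \<open>\<phi>\<close> to \<open>U\<close>.\<close>

definition weakly_seq_lsc_on :: "'a::real_normed_vector set \<Rightarrow> ('a \<Rightarrow> ereal) \<Rightarrow> bool" where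
  "weakly_seq_lsc_on U \<phi> \<longleftrightarrow>
     (\<forall>x\<in>U. \<forall>u :: nat \<Rightarrow> 'a. range u \<subseteq> U \<longrightarrow> limitin weak_topology u x sequentially \<longrightarrow>
        \<phi> x \<le> liminf (\<lambda>k. \<phi> (u k)))"

end

theory Submission
  imports Defs
begin

text \<open>
  For the given \<open>\<phi>1\<close> and \<open>\<phi>2\<close>, both parts are instances of one estimate: if \<open>V \<subseteq> W \<subseteq> U\<close> and the sublevel sets of \<open>\<phi>1\<close> in \<open>W\<close>
  are weakly sequentially compact, then \<open>\<Lambda>\<^sub>V\<^sup>\<circ>(\<phi>1, \<phi>2)\<close> is at least the infimum of
  \<open>\<phi>1 + \<phi>2\<close> over \<open>U\<close> (lemma \<open>INF_le_Lambda_circ\<close>). Part (i) takes \<open>V = W = U\<close>; part (ii) takes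
  \<open>V \<in> EI U\<close> and lets \<open>W\<close> be the weak closure of \<open>V\<close>.

  The estimate is the direct method of the calculus of variations. If it fails, there is a real
  number \<open>r\<close> strictly between the two quantities, and hence there are sequences \<open>x\<close> and \<open>y\<close> in \<open>V\<close>
  with \<open>x n - y n \<rightarrow> 0\<close> in norm and \<open>\<phi>1 (x n) + \<phi>2 (y n) < r\<close>. As \<open>\<phi>2\<close> is bounded below, \<open>x\<close> stays
  in a sublevel set of \<open>\<phi>1\<close>, so a subsequence of \<open>x\<close> converges weakly to some \<open>l \<in> W\<close>. The same
  subsequence of \<open>y\<close> then converges weakly to \<open>l\<close> as well (lemma \<open>limitin_weak_topology_shift\<close>), and
  weak lower semicontinuity gives \<open>\<phi>1 l + \<phi>2 l \<le> r\<close>, although \<open>r\<close> is below the infimum over \<open>U\<close>.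
\<close>

lemma openin_weak_topology_vimage:
  assumes "bounded_linear (f :: 'a::real_normed_vector \<Rightarrow> real)" "open S"
  shows "openin weak_topology (f -` S)"
  unfolding weak_topology_def using assms by (intro topology_generated_by_Basis) blast

lemma topspace_weak_topology [simp]:
  "topspace (weak_topology :: 'a::real_normed_vector topology) = UNIV"
  using openin_subset[OF openin_weak_topology_vimage[OF bounded_linear_zero open_UNIV]]
  by (simp add: top.extremum_unique)

lemma limitin_weak_topology_iff:
  fixes u :: "'b \<Rightarrow> 'a::real_normed_vector"
  shows "limitin weak_topology u l F \<longleftrightarrow>
    (\<forall>f :: 'a \<Rightarrow> real. bounded_linear f \<longrightarrow> ((\<lambda>n. f (u n)) \<longlongrightarrow> f l) F)"
proof (intro iffI allI impI)
  fix f :: "'a \<Rightarrow> real"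
  assume lim: "limitin weak_topology u l F" and f: "bounded_linear f"
  show "((\<lambda>n. f (u n)) \<longlongrightarrow> f l) F"
  proof (rule topological_tendstoI)
    fix S :: "real set" assume "open S" "f l \<in> S"
    then show "\<forall>\<^sub>F n in F. f (u n) \<in> S"
      using lim openin_weak_topology_vimage[OF f] unfolding limitin_def by fastforce
  qed
next
  assume lim: "\<forall>f :: 'a \<Rightarrow> real. bounded_linear f \<longrightarrow> ((\<lambda>n. f (u n)) \<longlongrightarrow> f l) F"
  let ?B = "{f -` S | (f :: 'a \<Rightarrow> real) S. bounded_linear f \<and> open S}"
  \<comment> \<open>The sets that \<open>u\<close> eventually enters as soon as they contain \<open>l\<close> are closed under finite
    intersections and arbitrary unions, so it suffices to look at the subbasis.\<close>
  have "l \<in> T \<longrightarrow> (\<forall>\<^sub>F n in F. u n \<in> T)" if "generate_topology_on ?B T" for T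
    using that
  proof induction
    case (UN K)
    then show ?case by (blast intro: eventually_mono)
  next
    case (Basis T)
    then obtain f :: "'a \<Rightarrow> real" and S where T: "T = f -` S" "bounded_linear f" "open S" by blast
    then have "((\<lambda>n. f (u n)) \<longlongrightarrow> f l) F"
      using lim by blast
    then show ?case
      using \<open>open S\<close> by (simp add: T topological_tendstoD)
  qed (auto intro: eventually_conj)
  then show "limitin weak_topology u l F"
    by (simp add: limitin_def) (simp add: weak_topology_def openin_topology_generated_by_iff)
qed

text \<open>Norm-null perturbations are invisible to continuous functionals.\<close>

lemma limitin_weak_topology_shift:
  fixes u v :: "'b \<Rightarrow> 'a::real_normed_vector"
  assumes lim: "limitin weak_topology u l F" and null: "((\<lambda>n. u n - v n) \<longlongrightarrow> 0) F"
  shows "limitin weak_topology v l F"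
  unfolding limitin_weak_topology_iff
proof (intro allI impI)
  fix f :: "'a \<Rightarrow> real" assume f: "bounded_linear f"
  have "((\<lambda>n. f (u n)) \<longlongrightarrow> f l) F"
    using lim f by (simp add: limitin_weak_topology_iff)
  then have "((\<lambda>n. f (u n) - f (u n - v n)) \<longlongrightarrow> f l - f 0) F"
    by (rule tendsto_diff[OF _ bounded_linear.tendsto[OF f null]])
  then show "((\<lambda>n. f (v n)) \<longlongrightarrow> f l) F"
    by (simp add: bounded_linear.linear[OF f] linear_diff linear_0)
qed

text \<open>The infima grow as \<open>\<eta>\<close> decreases, so their limit at \<open>0\<close> is their supremum.\<close>

lemma Lambda_inf_le_Lambda_circ:
  assumes "\<eta> > 0"
  shows "Lambda_inf V \<phi>1 \<phi>2 \<eta> \<le> Lambda_circ V \<phi>1 \<phi>2"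
proof (rule tendsto_lowerbound[OF tendsto_Lambda_circ])
  show "\<forall>\<^sub>F t in at_right 0. Lambda_inf V \<phi>1 \<phi>2 \<eta> \<le> Lambda_inf V \<phi>1 \<phi>2 t"
    unfolding eventually_at_right_field
    using assms by (intro exI[of _ \<eta>]) (auto intro: Lambda_inf_antimono)
qed (rule trivial_limit_at_right_real)

lemma Lambda_circ_less_imp_sequences:
  assumes "Lambda_circ V \<phi>1 \<phi>2 < r"
  obtains x y :: "nat \<Rightarrow> 'a::real_normed_vector"
  where "range x \<subseteq> V" "range y \<subseteq> V" "(\<lambda>n. x n - y n) \<longlonglongrightarrow> 0" "\<And>n. \<phi>1 (x n) + \<phi>2 (y n) < r"
proof -
  have "\<exists>p q. p \<in> V \<and> q \<in> V \<and> norm (p - q) < inverse (real (Suc n)) \<and> \<phi>1 p + \<phi>2 q < r" for n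
  proof -
    have "Lambda_inf V \<phi>1 \<phi>2 (inverse (real (Suc n))) < r"
      using Lambda_inf_le_Lambda_circ[of "inverse (real (Suc n))" V \<phi>1 \<phi>2] assms by auto
    then show ?thesis
      unfolding Lambda_inf_def by (auto simp: INF_less_iff)
  qed
  then obtain x y where xy: "\<And>n. x n \<in> V \<and> y n \<in> V \<and>
      norm (x n - y n) < inverse (real (Suc n)) \<and> \<phi>1 (x n) + \<phi>2 (y n) < r"
    by metis
  have "(\<lambda>n. x n - y n) \<longlonglongrightarrow> 0"
    by (rule Lim_null_comparison[OF _ LIMSEQ_inverse_real_of_nat])
      (use xy in \<open>auto intro: always_eventually less_imp_le\<close>)
  then show thesis using xy by (intro that[of x y]) auto
qed

text \<open>
  The set \<open>W\<close> sits between \<open>V\<close>, where the almost minimizing sequences live, and \<open>U\<close>, where the lower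
  semicontinuity is known: it only has to catch the weak limit.
\<close>

lemma INF_le_Lambda_circ:
  fixes \<phi>1 \<phi>2 :: "'a::real_normed_vector \<Rightarrow> ereal"
  assumes proper: "never_minus_infinity \<phi>1" "never_minus_infinity \<phi>2"
    and lsc: "weakly_seq_lsc_on U \<phi>1" "weakly_seq_lsc_on U \<phi>2"
    and below: "(INF x\<in>U. \<phi>2 x) > - \<infinity>"
    and VW: "V \<subseteq> W" and WU: "W \<subseteq> U"
    and compact: "\<And>c::real. weakly_seq_compact {x \<in> W. \<phi>1 x \<le> ereal c}"
  shows "(INF x\<in>U. \<phi>1 x + \<phi>2 x) \<le> Lambda_circ V \<phi>1 \<phi>2"
proof (rule ccontr)
  assume "\<not> ?thesis"
  then obtain r :: real where r: "Lambda_circ V \<phi>1 \<phi>2 < r" "r < (INF x\<in>U. \<phi>1 x + \<phi>2 x)"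
    using ereal_dense2[of "Lambda_circ V \<phi>1 \<phi>2"] by (auto simp: not_le)
  obtain x y where x: "range x \<subseteq> V" and y: "range y \<subseteq> V"
    and null: "(\<lambda>n. x n - y n) \<longlonglongrightarrow> 0" and small: "\<And>n. \<phi>1 (x n) + \<phi>2 (y n) < r"
    using Lambda_circ_less_imp_sequences[OF r(1)] by blast
  \<comment> \<open>The infimum of \<open>\<phi>2\<close> may be \<open>\<infinity>\<close>, so a real lower bound is chosen below it.\<close>
  obtain m :: real where m: "m < (INF x\<in>U. \<phi>2 x)"
    using ereal_dense2[OF below] by blast
  have "\<phi>1 (x n) \<le> ereal (r - m)" for n
  proof -
    have "ereal m \<le> \<phi>2 (y n)"
      using y VW WU by (intro order.trans[OF less_imp_le[OF m]] INF_lower) auto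
    with small[of n] show ?thesis
      by (cases "\<phi>1 (x n)"; cases "\<phi>2 (y n)") auto
  qed
  then have "range x \<subseteq> {x \<in> W. \<phi>1 x \<le> ereal (r - m)}"
    using x VW by auto
  then obtain l s where l: "l \<in> W" and s: "strict_mono s"
    and xl: "limitin weak_topology (x \<circ> s) l sequentially"
    using compact[of "r - m"] unfolding weakly_seq_compact_def by blast
  have yl: "limitin weak_topology (y \<circ> s) l sequentially"
    using LIMSEQ_subseq_LIMSEQ[OF null s]
    by (intro limitin_weak_topology_shift[OF xl]) (simp add: o_def)
  have "l \<in> U" "range (x \<circ> s) \<subseteq> U" "range (y \<circ> s) \<subseteq> U"
    using l x y VW WU by auto
  then have le1: "\<phi>1 l \<le> liminf (\<lambda>k. \<phi>1 ((x \<circ> s) k))" and le2: "\<phi>2 l \<le> liminf (\<lambda>k. \<phi>2 ((y \<circ> s) k))"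
    using lsc xl yl unfolding weakly_seq_lsc_on_def by blast+
  have "(INF x\<in>U. \<phi>1 x + \<phi>2 x) \<le> \<phi>1 l + \<phi>2 l"
    using \<open>l \<in> U\<close> by (rule INF_lower)
  also have "\<dots> \<le> liminf (\<lambda>k. \<phi>1 ((x \<circ> s) k)) + liminf (\<lambda>k. \<phi>2 ((y \<circ> s) k))"
    using le1 le2 by (rule add_mono)
  also have "\<dots> \<le> liminf (\<lambda>k. \<phi>1 ((x \<circ> s) k) + \<phi>2 ((y \<circ> s) k))"
    \<comment> \<open>Lower semicontinuity keeps both lower limits above \<open>-\<infinity>\<close>, so \<open>\<infinity> - \<infinity>\<close> cannot occur.\<close>
    using le1 le2 proper unfolding never_minus_infinity_def
    by (intro ereal_liminf_add_mono) auto
  also have "\<dots> \<le> liminf (\<lambda>k::nat. ereal r)"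
    using small by (intro Liminf_mono always_eventually) (auto intro: less_imp_le)
  also have "\<dots> = r" by (simp add: Liminf_const)
  finally show False using r(2) by simp
qed

theorem proposition4p12:
  fixes \<phi>1 \<phi>2 :: "'a::real_normed_vector \<Rightarrow> ereal" and U :: "'a set"
  assumes "never_minus_infinity \<phi>1" and "never_minus_infinity \<phi>2"
    and "eff_dom \<phi>1 \<inter> eff_dom \<phi>2 \<inter> U \<noteq> {}"
    and "weakly_seq_lsc_on U \<phi>1" and "weakly_seq_lsc_on U \<phi>2"
    and "(INF x\<in>U. \<phi>2 x) > - \<infinity>"
  shows "((\<forall>c::real. weakly_seq_compact {x \<in> U. \<phi>1 x \<le> ereal c})
            \<longrightarrow> uniformly_lsc_pair U \<phi>1 \<phi>2) \<and>
         ((\<forall>V\<in>EI U. weak_topology closure_of V \<subseteq> U \<and>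
              (\<forall>c::real. weakly_seq_compact {x \<in> weak_topology closure_of V. \<phi>1 x \<le> ereal c}))
            \<longrightarrow> quasiuniformly_lsc_pair U \<phi>1 \<phi>2)"
proof (intro conjI impI)
  assume "\<forall>c::real. weakly_seq_compact {x \<in> U. \<phi>1 x \<le> ereal c}"
  then show "uniformly_lsc_pair U \<phi>1 \<phi>2"
    unfolding uniformly_lsc_pair_def
    using assms by (intro INF_le_Lambda_circ[where W = U]) auto
next
  assume closures: "\<forall>V\<in>EI U. weak_topology closure_of V \<subseteq> U \<and>
      (\<forall>c::real. weakly_seq_compact {x \<in> weak_topology closure_of V. \<phi>1 x \<le> ereal c})"
  have "(INF x\<in>U. \<phi>1 x + \<phi>2 x) \<le> Lambda_circ V \<phi>1 \<phi>2" if "V \<in> EI U" for V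
    using assms closures that
    by (intro INF_le_Lambda_circ[where W = "weak_topology closure_of V"])
      (auto intro!: closure_of_subset)
  then show "quasiuniformly_lsc_pair U \<phi>1 \<phi>2"
    unfolding quasiuniformly_lsc_pair_def Lambda_dagger_def by (rule INF_greatest)
qed

end
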